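(* Let $G$ be a branchwise commutative solid weak BCC-algebra. If $I(G)$ is a BCK-ideal of $G$ and $$(xy)(0y)=\big(((xy)y)(0y)\big)(0y)$$ holds for all $x,y$ belonging to the same branch, then $G$ is branchwise implicative.
   Context: The operation is written by juxtaposition. A weak BCC-algebra is a set $G$ with a binary operation and a constant $0$ such that for all $x,y,z\in G$: $((xy)(zy))(xz)=0$; $xx=0$; $x0=x$; and $xy=yx=0$ implies $x=y$. Its natural partial order is $x\leqslant y\iff xy=0$. $I(G)$ denotes the set of minimal elements of $(G,\leqslant)$; for $a\in I(G)$ the branch initiated by $a$ is $B(a)=\{x\in G: a\leqslant x\}$. Elements $x,y$ are in the same branch if $x,y\in B(a)$ for some $a\in I(G)$. $G$ is solid if $(xy)z=(xz)y$ for all $x,y$ belonging to the same branch and all $z\in G$. $G$ is branchwise commutative if $x(xy)=y(yx)$ for all $x,y$ belonging to the same branch, and branchwise implicative if $x(yx)=x$ for all $x,y$ belonging to the same branch. A BCK-ideal of $G$ is a subset $A\subseteq G$ such that $0\in A$, and $y\in A$, $xy\in A$ imply $x\in A$. *)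

theory Defs
  imports Main
begin

locale weak_BCC_algebra =
  fixes G :: "'a set"
    and mult :: "'a \<Rightarrow> 'a \<Rightarrow> 'a"  (infixl "\<cdot>" 70)
    and zero :: 'a  ("\<zero>")
  assumes mult_closed: "x \<in> G \<Longrightarrow> y \<in> G \<Longrightarrow> x \<cdot> y \<in> G"
    and zero_closed: "\<zero> \<in> G"
    and weak_BCC: "x \<in> G \<Longrightarrow> y \<in> G \<Longrightarrow> z \<in> G \<Longrightarrow> ((x \<cdot> y) \<cdot> (z \<cdot> y)) \<cdot> (x \<cdot> z) = \<zero>"
    and mult_self: "x \<in> G \<Longrightarrow> x \<cdot> x = \<zero>"
    and mult_zero: "x \<in> G \<Longrightarrow> x \<cdot> \<zero> = x"
    and mult_antisym: "x \<in> G \<Longrightarrow> y \<in> G \<Longrightarrow> x \<cdot> y = \<zero> \<Longrightarrow> y \<cdot> x = \<zero> \<Longrightarrow> x = y"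
begin

definition le :: "'a \<Rightarrow> 'a \<Rightarrow> bool"  (infix "\<preceq>" 50)
  where "x \<preceq> y \<longleftrightarrow> x \<cdot> y = \<zero>"

definition minimal_elements :: "'a set"
  where "minimal_elements = {a \<in> G. \<forall>x\<in>G. x \<preceq> a \<longrightarrow> x = a}"

definition branch :: "'a \<Rightarrow> 'a set"
  where "branch a = {x \<in> G. a \<preceq> x}"

definition same_branch :: "'a \<Rightarrow> 'a \<Rightarrow> bool"
  where "same_branch x y \<longleftrightarrow> (\<exists>a\<in>minimal_elements. x \<in> branch a \<and> y \<in> branch a)"

definition solid :: bool
  where "solid \<longleftrightarrow> (\<forall>x\<in>G. \<forall>y\<in>G. \<forall>z\<in>G. same_branch x y \<longrightarrow> (x \<cdot> y) \<cdot> z = (x \<cdot> z) \<cdot> y)"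

definition branchwise_commutative :: bool
  where "branchwise_commutative \<longleftrightarrow>
    (\<forall>x\<in>G. \<forall>y\<in>G. same_branch x y \<longrightarrow> x \<cdot> (x \<cdot> y) = y \<cdot> (y \<cdot> x))"

definition branchwise_implicative :: bool
  where "branchwise_implicative \<longleftrightarrow>
    (\<forall>x\<in>G. \<forall>y\<in>G. same_branch x y \<longrightarrow> x \<cdot> (y \<cdot> x) = x)"

definition BCK_ideal :: "'a set \<Rightarrow> bool"
  where "BCK_ideal A \<longleftrightarrow>
    A \<subseteq> G \<and> \<zero> \<in> A \<and> (\<forall>x\<in>G. \<forall>y\<in>G. y \<in> A \<and> x \<cdot> y \<in> A \<longrightarrow> x \<in> A)"

end

end

theory Submission
  imports Defs
begin

text \<open>
  In a BCK-algebra the displayed identity reads \<open>xy = (xy)y\<close>, and a commutative algebra with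
  this property is implicative because \<open>(yx)x = yx\<close> forces the meet \<open>x(x(yx))\<close> of \<open>x\<close> and \<open>yx\<close>
  to vanish. The proof below transports this argument to a branch.

  Let \<open>x\<close>, \<open>y\<close> lie in one branch, and put \<open>v = yx\<close>, \<open>c = 0x\<close>, \<open>u = xv\<close> and \<open>w = xu\<close>. The elements
  \<open>v\<close> and \<open>w\<close> lie in the branch of \<open>0\<close>, and \<open>c\<close> is minimal. Since the minimal elements form an
  ideal, right multiplication by \<open>c\<close> can be cancelled inside the branch of \<open>0\<close>
  (lemma \<open>minimal_right_cancel\<close>), so the identity becomes \<open>v = (vx)c\<close>.
  As \<open>u\<close> lies in the branch of \<open>x\<close>, \<open>wx = (xx)u = 0u = 0x = c\<close> (lemma \<open>zero_mult_cong_le\<close>),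
  so \<open>(wx)c = 0\<close>. Applying the main axiom twice gives
  \<open>v = ((vx)c)((wx)c) \<le> (vx)(wx) \<le> vw \<le> v\<close>, that is, \<open>vw = v\<close>. Finally \<open>w \<le> v\<close>, so
  commutativity in the branch of \<open>0\<close> yields \<open>w = v(vw) = 0\<close>, which says \<open>x \<le> x(yx)\<close>;
  the reverse inequality is immediate from solidity.
\<close>

context weak_BCC_algebra
begin

lemma le_zeroD:
  assumes "x \<in> G" "x \<preceq> \<zero>" shows "x = \<zero>"
  using assms mult_zero le_def by simp

lemma le_trans:
  assumes "x \<in> G" "y \<in> G" "z \<in> G" "x \<preceq> y" "y \<preceq> z" shows "x \<preceq> z"
proof -
  have "((x \<cdot> z) \<cdot> (y \<cdot> z)) \<cdot> (x \<cdot> y) = \<zero>" using assms weak_BCC by blast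
  then show ?thesis using assms by (simp add: le_def mult_zero mult_closed zero_closed)
qed

lemma mult_right_mono:
  assumes "x \<in> G" "y \<in> G" "z \<in> G" "x \<preceq> y" shows "x \<cdot> z \<preceq> y \<cdot> z"
proof -
  have "((x \<cdot> z) \<cdot> (y \<cdot> z)) \<cdot> (x \<cdot> y) = \<zero>" using assms weak_BCC by blast
  then show ?thesis using assms by (simp add: le_def mult_zero mult_closed)
qed

lemma mult_left_antimono:
  assumes "x \<in> G" "y \<in> G" "z \<in> G" "y \<preceq> z" shows "x \<cdot> z \<preceq> x \<cdot> y"
proof -
  have "((x \<cdot> z) \<cdot> (y \<cdot> z)) \<cdot> (x \<cdot> y) = \<zero>" using assms weak_BCC by blast
  then show ?thesis using assms by (simp add: le_def mult_zero mult_closed)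
qed

lemma zero_minimal: "\<zero> \<in> minimal_elements"
  using le_zeroD zero_closed by (auto simp: minimal_elements_def)

lemma same_branch_zeroI:
  assumes "x \<in> G" "y \<in> G" "\<zero> \<cdot> x = \<zero>" "\<zero> \<cdot> y = \<zero>" shows "same_branch x y"
  using assms zero_minimal by (auto simp: same_branch_def branch_def le_def)

lemma same_branch_zero_mult:
  assumes "same_branch x y" shows "\<zero> \<cdot> (x \<cdot> y) = \<zero>"
proof -
  obtain a where a: "a \<in> G" "x \<in> G" "y \<in> G" "a \<preceq> x" "a \<cdot> y = \<zero>"
    using assms by (auto simp: same_branch_def branch_def minimal_elements_def le_def)
  have "a \<cdot> y \<preceq> x \<cdot> y" using a mult_right_mono by blast
  then show ?thesis using a by (simp add: le_def)
qed

lemma zero_mult_zero_mult_le: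
  assumes "x \<in> G" shows "\<zero> \<cdot> (\<zero> \<cdot> x) \<preceq> x"
  using weak_BCC[of x x \<zero>] assms by (simp add: le_def mult_self mult_zero zero_closed)

lemma triple_zero_mult:
  assumes "x \<in> G" shows "\<zero> \<cdot> (\<zero> \<cdot> (\<zero> \<cdot> x)) = \<zero> \<cdot> x"
proof -
  have "\<zero> \<cdot> x \<preceq> \<zero> \<cdot> (\<zero> \<cdot> (\<zero> \<cdot> x))"
    using assms
    by (intro mult_left_antimono zero_mult_zero_mult_le) (simp_all add: mult_closed zero_closed)
  moreover have "\<zero> \<cdot> (\<zero> \<cdot> (\<zero> \<cdot> x)) \<preceq> \<zero> \<cdot> x"
    using assms by (simp add: zero_mult_zero_mult_le mult_closed zero_closed)
  ultimately show ?thesis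
    using mult_antisym assms mult_closed zero_closed by (simp add: le_def)
qed

lemma solidD:
  assumes "solid" "same_branch x y" "z \<in> G" shows "(x \<cdot> y) \<cdot> z = (x \<cdot> z) \<cdot> y"
  using assms unfolding solid_def same_branch_def branch_def by blast

text \<open>Left multiplication by \<open>0\<close> sends comparable elements to the same element, so it is constant
  on every branch; with \<open>triple_zero_mult\<close> this makes all its values minimal.\<close>
lemma zero_mult_cong_le:
  assumes "solid" and x: "x \<in> G" and y: "y \<in> G" and le: "x \<preceq> y"
  shows "\<zero> \<cdot> x = \<zero> \<cdot> y"
proof -
  define v where "v = y \<cdot> x"
  define e where "e = \<zero> \<cdot> x"
  have G: "v \<in> G" "e \<in> G" using x y by (auto simp: v_def e_def mult_closed zero_closed)
  have "x \<cdot> x \<preceq> y \<cdot> x" using mult_right_mono x y le by blast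
  then have v0: "\<zero> \<cdot> v = \<zero>" by (simp add: v_def le_def mult_self x)
  \<comment> \<open>As \<open>e = 0(0e)\<close>, solidity for the pair \<open>0\<close>, \<open>v\<close> shows that \<open>v\<close> acts trivially on \<open>e\<close>.\<close>
  have "same_branch \<zero> v" using G v0 by (simp add: same_branch_zeroI zero_closed mult_self)
  then have "(\<zero> \<cdot> v) \<cdot> (\<zero> \<cdot> e) = (\<zero> \<cdot> (\<zero> \<cdot> e)) \<cdot> v"
    using G by (intro solidD[OF \<open>solid\<close>]) (simp_all add: mult_closed zero_closed)
  then have "e \<cdot> v = e" using triple_zero_mult[OF x] v0 by (simp add: e_def)
  moreover have "((\<zero> \<cdot> x) \<cdot> (y \<cdot> x)) \<cdot> (\<zero> \<cdot> y) = \<zero>"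
    using weak_BCC x y zero_closed by blast
  ultimately have "(\<zero> \<cdot> x) \<cdot> (\<zero> \<cdot> y) = \<zero>" by (simp add: e_def v_def)
  moreover have "\<zero> \<cdot> y \<preceq> \<zero> \<cdot> x" using mult_left_antimono x y le zero_closed by blast
  ultimately show ?thesis using mult_antisym x y mult_closed zero_closed by (simp add: le_def)
qed

lemma zero_mult_minimal:
  assumes "solid" and x: "x \<in> G" shows "\<zero> \<cdot> x \<in> minimal_elements"
proof -
  have "z = \<zero> \<cdot> x" if z: "z \<in> G" "z \<preceq> \<zero> \<cdot> x" for z
  proof -
    have "\<zero> \<cdot> z = \<zero> \<cdot> (\<zero> \<cdot> x)"
      using z x by (intro zero_mult_cong_le[OF \<open>solid\<close>]) (simp_all add: mult_closed zero_closed)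
    then have "\<zero> \<cdot> x \<preceq> z" using zero_mult_zero_mult_le[OF z(1)] triple_zero_mult[OF x] by simp
    then show ?thesis using z x mult_antisym mult_closed zero_closed by (simp add: le_def)
  qed
  then show ?thesis using x mult_closed zero_closed by (auto simp: minimal_elements_def)
qed

text \<open>If \<open>xc = yc\<close>, solidity gives \<open>(xy)c = (xc)y = (yc)y = (yy)c = 0c\<close>, which is minimal. The ideal
  property then makes \<open>xy\<close> minimal, and \<open>0 \<le> xy\<close> because \<open>x\<close> and \<open>y\<close> share a branch.\<close>
lemma minimal_right_cancel_le:
  assumes "solid" "BCK_ideal minimal_elements" "c \<in> minimal_elements"
    and xy: "same_branch x y" and eq: "x \<cdot> c = y \<cdot> c"
  shows "x \<preceq> y"
proof -
  have G: "x \<in> G" "y \<in> G" "c \<in> G"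
    using assms by (auto simp: same_branch_def branch_def minimal_elements_def)
  have yy: "same_branch y y" using xy by (auto simp: same_branch_def)
  have "(x \<cdot> y) \<cdot> c = (y \<cdot> c) \<cdot> y" using solidD[OF \<open>solid\<close> xy G(3)] eq by simp
  also have "\<dots> = \<zero> \<cdot> c" using solidD[OF \<open>solid\<close> yy G(3)] mult_self G by simp
  finally have "(x \<cdot> y) \<cdot> c \<in> minimal_elements" using zero_mult_minimal \<open>solid\<close> G by simp
  then have "x \<cdot> y \<in> minimal_elements"
    using assms(2,3) G mult_closed unfolding BCK_ideal_def by blast
  then have "x \<cdot> y = \<zero>"
    using same_branch_zero_mult[OF xy] zero_closed by (auto simp: minimal_elements_def le_def)
  then show ?thesis by (simp add: le_def)
qed

lemma minimal_right_cancel: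
  assumes "solid" "BCK_ideal minimal_elements" "c \<in> minimal_elements"
    and xy: "same_branch x y" and eq: "x \<cdot> c = y \<cdot> c"
  shows "x = y"
proof -
  have yx: "same_branch y x" using xy by (auto simp: same_branch_def)
  have "x \<in> G" "y \<in> G" using xy by (auto simp: same_branch_def branch_def)
  then show ?thesis
    using minimal_right_cancel_le[OF assms] minimal_right_cancel_le[OF assms(1-3) yx eq[symmetric]]
      mult_antisym by (simp add: le_def)
qed

lemma branchwise_implicativeI:
  assumes solid: "solid" and comm: "branchwise_commutative"
    and ideal: "BCK_ideal minimal_elements"
    and identity: "\<And>x y. same_branch x y \<Longrightarrow>
      (x \<cdot> y) \<cdot> (\<zero> \<cdot> y) = (((x \<cdot> y) \<cdot> y) \<cdot> (\<zero> \<cdot> y)) \<cdot> (\<zero> \<cdot> y)"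
  shows "branchwise_implicative"
  unfolding branchwise_implicative_def
proof (intro ballI impI)
  fix x y
  assume G: "x \<in> G" "y \<in> G" and xy: "same_branch x y"
  obtain a where a: "a \<in> minimal_elements" "a \<preceq> x"
    using xy by (auto simp: same_branch_def branch_def)
  have aG: "a \<in> G" using a(1) by (simp add: minimal_elements_def)
  have yx: "same_branch y x" and xx: "same_branch x x" using xy by (auto simp: same_branch_def)
  define c where "c = \<zero> \<cdot> x"
  define v where "v = y \<cdot> x"
  define u where "u = x \<cdot> v"
  define w where "w = x \<cdot> u"
  have GG: "c \<in> G" "v \<in> G" "u \<in> G" "w \<in> G"
    using G by (auto simp: c_def v_def u_def w_def mult_closed zero_closed)
  note cl = G GG aG mult_closed zero_closed
  have v0: "\<zero> \<cdot> v = \<zero>" using same_branch_zero_mult[OF yx] by (simp add: v_def)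

  have v_eq: "v = (v \<cdot> x) \<cdot> c"
  proof (rule minimal_right_cancel[OF solid ideal])
    show "c \<in> minimal_elements" using zero_mult_minimal solid G by (simp add: c_def)
    have "c \<preceq> v \<cdot> x" using mult_right_mono[of \<zero> v x] v0 cl by (simp add: c_def le_def)
    then have "c \<cdot> c \<preceq> (v \<cdot> x) \<cdot> c" using cl by (simp add: mult_right_mono)
    then have "\<zero> \<cdot> ((v \<cdot> x) \<cdot> c) = \<zero>" using mult_self cl by (simp add: le_def)
    then show "same_branch v ((v \<cdot> x) \<cdot> c)" using v0 cl by (intro same_branch_zeroI) simp_all
    show "v \<cdot> c = ((v \<cdot> x) \<cdot> c) \<cdot> c" using identity[OF yx] by (simp add: v_def c_def)
  qed

  \<comment> \<open>Since \<open>0 \<le> v\<close> and \<open>a\<close> is minimal, \<open>av = a\<close>; hence \<open>a = av \<le> xv = u\<close>.\<close>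
  have "a \<cdot> v \<preceq> a \<cdot> \<zero>" using mult_left_antimono v0 cl by (simp add: le_def)
  then have "a \<cdot> v = a" using a(1) mult_zero cl by (auto simp: minimal_elements_def)
  then have au: "a \<preceq> u" using mult_right_mono[of a x v] a(2) cl by (simp add: u_def)
  have xu: "same_branch x u" using a au cl by (auto simp: same_branch_def branch_def)
  have w0: "\<zero> \<cdot> w = \<zero>" using same_branch_zero_mult[OF xu] by (simp add: w_def)
  have wv: "w \<cdot> v = \<zero>" using solidD[OF solid xu, of v] mult_self cl by (simp add: w_def u_def)
  have "\<zero> \<cdot> u = \<zero> \<cdot> x"
    using zero_mult_cong_le[OF solid aG GG(3) au] zero_mult_cong_le[OF solid aG G(1) a(2)] by simp
  then have wx: "w \<cdot> x = c"
    using solidD[OF solid xx, of u] mult_self cl by (simp add: w_def c_def)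

  have "((v \<cdot> x) \<cdot> c) \<cdot> ((w \<cdot> x) \<cdot> c) \<preceq> (v \<cdot> x) \<cdot> (w \<cdot> x)"
    using weak_BCC[of "v \<cdot> x" c "w \<cdot> x"] cl by (simp add: le_def)
  then have "v \<preceq> (v \<cdot> x) \<cdot> (w \<cdot> x)" using v_eq[symmetric] wx mult_self mult_zero cl by simp
  moreover have "(v \<cdot> x) \<cdot> (w \<cdot> x) \<preceq> v \<cdot> w" using weak_BCC cl by (simp add: le_def)
  ultimately have v_le: "v \<preceq> v \<cdot> w"
    using le_trans[of v "(v \<cdot> x) \<cdot> (w \<cdot> x)" "v \<cdot> w"] cl by simp
  have vv: "same_branch v v" and vw: "same_branch v w"
    using v0 w0 cl by (simp_all add: same_branch_zeroI)
  have "(v \<cdot> w) \<cdot> v = \<zero>" using solidD[OF solid vv, of w] mult_self w0 cl by simp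
  then have "v \<cdot> w = v" using mult_antisym v_le cl by (simp add: le_def)
  moreover have "v \<cdot> (v \<cdot> w) = w \<cdot> (w \<cdot> v)"
    using comm vw GG unfolding branchwise_commutative_def by blast
  ultimately have "x \<cdot> u = \<zero>" using wv mult_self mult_zero GG by (simp add: w_def)
  moreover have "u \<cdot> x = \<zero>" using solidD[OF solid xx, of v] mult_self v0 cl by (simp add: u_def)
  ultimately have "u = x" using mult_antisym G GG by blast
  then show "x \<cdot> (y \<cdot> x) = x" by (simp add: u_def v_def)
qed

end

theorem theorem5p5:
  fixes G :: "'a set"
    and mult :: "'a \<Rightarrow> 'a \<Rightarrow> 'a"  (infixl "\<cdot>" 70)
    and zero :: 'a  ("\<zero>")
  assumes "weak_BCC_algebra G (\<cdot>) \<zero>"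
    and "weak_BCC_algebra.solid G (\<cdot>) \<zero>"
    and "weak_BCC_algebra.branchwise_commutative G (\<cdot>) \<zero>"
    and "weak_BCC_algebra.BCK_ideal G (\<cdot>) \<zero> (weak_BCC_algebra.minimal_elements G (\<cdot>) \<zero>)"
    and "\<forall>x\<in>G. \<forall>y\<in>G. weak_BCC_algebra.same_branch G (\<cdot>) \<zero> x y \<longrightarrow>
           (x \<cdot> y) \<cdot> (\<zero> \<cdot> y) = (((x \<cdot> y) \<cdot> y) \<cdot> (\<zero> \<cdot> y)) \<cdot> (\<zero> \<cdot> y)"
  shows "weak_BCC_algebra.branchwise_implicative G (\<cdot>) \<zero>"
proof -
  interpret weak_BCC_algebra G "(\<cdot>)" \<zero> by fact
  show ?thesis
  proof (rule branchwise_implicativeI[OF assms(2-4)])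
    fix x y assume "same_branch x y"
    moreover have "x \<in> G" "y \<in> G"
      using \<open>same_branch x y\<close> by (auto simp: same_branch_def branch_def)
    ultimately show "(x \<cdot> y) \<cdot> (\<zero> \<cdot> y) = (((x \<cdot> y) \<cdot> y) \<cdot> (\<zero> \<cdot> y)) \<cdot> (\<zero> \<cdot> y)"
      using assms(5) by blast
  qed
qed

end
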